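(* Let $K$ be a field, let $I \subset R=K[x,y,z]$ be a monomial ideal, $\mathfrak{m}=(x,y,z)$, $k\geq 3$, and let $$\mathcal{G}(I)=\{x^{r_{1,1}} y^{r_{1,2}} z^{r_{1,3}}, \ldots, x^{r_{k,1}} y^{r_{k,2}} z^{r_{k,3}}\}$$ (the $k$ listed monomials being distinct). Suppose there exists an index $s$ with $1\leq s \leq k-2$ such that (a) $r_{1,1} \geq r_{2,1} \geq \cdots \geq r_{s,1} > r_{s+1,1}$ and $r_{s,1} > r_{s+2,1}$; (b) $r_{s+1,2} > r_{s,2}$ and $r_{s+1,2} > r_{s+2,2}$; (c) $r_{s+1,3} < r_{s+2,3} \leq r_{s+3,3}\leq \cdots \leq r_{k,3}$ and $r_{s,3} < r_{s+2,3}$. Then $\mathfrak{m} \in \mathrm{Ass}(R/I)$. In particular, $h=x^{r_{s,1}-1} y^{r_{s+1,2}-1} z^{r_{s+2,3}-1}\in \mathrm{C}_R(I)$ and $\mathrm{P}_R(h)=(x^{r_{s,1}}, y^{r_{s+1,2}}, z^{r_{s+2,3}})$ appears in the irredundant irreducible decomposition of $I$.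
   Context: $\mathcal{G}(I)$ denotes the unique minimal set of monomial generators of a monomial ideal $I$. $\mathrm{Ass}(R/I)$ is the set of associated primes of $I$, i.e. primes of the form $(I:v)$ with $v\in R$. For a monomial $f=x^{a}y^{b}z^{c}$, $\mathrm{P}_R(f)=(x^{a+1},y^{b+1},z^{c+1})$. A monomial $f\in R$ is an $I$-corner element if $f\notin I$ and $xf,yf,zf\in I$; $\mathrm{C}_R(I)$ is the set of $I$-corner elements. The irredundant irreducible decomposition of a monomial ideal $I$ is its unique irredundant expression as a finite intersection of ideals generated by powers of variables. *)

theory Defs
  imports
    "HOL-Algebra.Algebraic_Closure_Type"
    "HOL-Library.Poly_Mapping"
    "HOL-Library.Product_Plus"
begin

text \<open>
  The polynomial ring \<open>K[x,y,z]\<close> is the monoid algebra of \<open>\<nat>\<^sup>3\<close> over \<open>K\<close>: finitely supported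
  functions on exponent triples, with the convolution product of \<^theory>\<open>HOL-Library.Poly_Mapping\<close>.
\<close>

type_synonym 'k poly3 = "(nat \<times> nat \<times> nat) \<Rightarrow>\<^sub>0 'k"

text \<open>The same ring as a HOL-Algebra structure; its carrier is the whole type.\<close>

abbreviation poly3_ring :: "'k::field poly3 ring"
  where "poly3_ring \<equiv> ring_of_type_algebra"

abbreviation ideal_gen :: "'k::field poly3 set \<Rightarrow> 'k poly3 set"
  where "ideal_gen S \<equiv> genideal poly3_ring S"

definition var_x :: "'k::field poly3" where "var_x = Poly_Mapping.single (1, 0, 0) 1"
definition var_y :: "'k::field poly3" where "var_y = Poly_Mapping.single (0, 1, 0) 1"
definition var_z :: "'k::field poly3" where "var_z = Poly_Mapping.single (0, 0, 1) 1"

definition xyz_mon :: "nat \<Rightarrow> nat \<Rightarrow> nat \<Rightarrow> 'k::field poly3"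
  where "xyz_mon a b c = var_x ^ a * var_y ^ b * var_z ^ c"

definition monomials :: "'k::field poly3 set"
  where "monomials = {xyz_mon a b c | a b c. True}"

definition monomial_ideal :: "'k::field poly3 set \<Rightarrow> bool"
  where "monomial_ideal I \<longleftrightarrow> (\<exists>S \<subseteq> monomials. I = ideal_gen S)"

text \<open>\<open>minimal_monomial_generators I G\<close> says \<open>G = \<G>(I)\<close>; minimality is with respect to inclusion.\<close>

definition minimal_monomial_generators :: "'k::field poly3 set \<Rightarrow> 'k poly3 set \<Rightarrow> bool"
  where "minimal_monomial_generators I G \<longleftrightarrow>
    G \<subseteq> monomials \<and> ideal_gen G = I \<and> (\<forall>H. H \<subset> G \<longrightarrow> ideal_gen H \<noteq> I)"

definition maximal_m :: "'k::field poly3 set"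
  where "maximal_m = ideal_gen {var_x, var_y, var_z}"

definition ideal_colon :: "'k::field poly3 set \<Rightarrow> 'k poly3 \<Rightarrow> 'k poly3 set"
  where "ideal_colon I v = {f. f * v \<in> I}"

definition Ass :: "'k::field poly3 set \<Rightarrow> 'k poly3 set set"
  where "Ass I = {P. primeideal P poly3_ring \<and> (\<exists>v. P = ideal_colon I v)}"

definition corner_elements :: "'k::field poly3 set \<Rightarrow> 'k poly3 set"
  where "corner_elements I =
    {f \<in> monomials. f \<notin> I \<and> var_x * f \<in> I \<and> var_y * f \<in> I \<and> var_z * f \<in> I}"

text \<open>
  Meaningful for monomials only: the exponent triple is read off as the unique element of the
  support, see \<open>P_R_xyz_mon\<close> below.
\<close>

definition P_R :: "'k::field poly3 \<Rightarrow> 'k poly3 set"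
  where "P_R f = (case the_elem (Poly_Mapping.keys f) of
    (a, b, c) \<Rightarrow> ideal_gen {var_x ^ (a + 1), var_y ^ (b + 1), var_z ^ (c + 1)})"

definition gen_by_variable_powers :: "'k::field poly3 set \<Rightarrow> bool"
  where "gen_by_variable_powers J \<longleftrightarrow>
    (\<exists>S \<subseteq> {v ^ n | v n. v \<in> {var_x, var_y, var_z} \<and> n \<ge> 1}. J = ideal_gen S)"

text \<open>
  The intersection is taken in the whole ring, so the unit ideal has the empty decomposition.
\<close>

definition irredundant_irreducible_decomposition ::
    "'k::field poly3 set \<Rightarrow> 'k poly3 set set \<Rightarrow> bool"
  where "irredundant_irreducible_decomposition I D \<longleftrightarrow>
    finite D \<and> (\<forall>J\<in>D. gen_by_variable_powers J) \<and> \<Inter>D = I \<and> (\<forall>J\<in>D. \<Inter>(D - {J}) \<noteq> I)"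

lemma var_power:
  "(var_x :: 'k::field poly3) ^ n = Poly_Mapping.single (n, 0, 0) 1"
  "(var_y :: 'k::field poly3) ^ n = Poly_Mapping.single (0, n, 0) 1"
  "(var_z :: 'k::field poly3) ^ n = Poly_Mapping.single (0, 0, n) 1"
  by (induction n)
    (simp_all add: var_x_def var_y_def var_z_def Poly_Mapping.mult_single
      flip: Poly_Mapping.single_one zero_prod_def)

lemma xyz_mon_eq_single: "(xyz_mon a b c :: 'k::field poly3) = Poly_Mapping.single (a, b, c) 1"
  by (simp add: xyz_mon_def var_power Poly_Mapping.mult_single)

lemma P_R_xyz_mon:
  "P_R (xyz_mon a b c :: 'k::field poly3) =
    ideal_gen {var_x ^ (a + 1), var_y ^ (b + 1), var_z ^ (c + 1)}"
  by (simp add: P_R_def xyz_mon_eq_single)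

end

theory Submission
  imports Defs "HOL-Library.Product_Order"
begin

text \<open>
  Write \<open>h = x\<^sup>a y\<^sup>b z\<^sup>c\<close>. The generators with index at most \<open>s\<close> have \<open>x\<close>-exponent above \<open>a\<close>, the
  generator \<open>s + 1\<close> has \<open>y\<close>-exponent \<open>b + 1\<close>, and those from \<open>s + 2\<close> on have \<open>z\<close>-exponent
  above \<open>c\<close>, so none of them divides \<open>h\<close>. Conversely the strict inequalities among the generators
  \<open>s\<close>, \<open>s + 1\<close>, \<open>s + 2\<close> say that they divide \<open>x h\<close>, \<open>y h\<close>, \<open>z h\<close> respectively. Hence \<open>h\<close> is a
  corner element, and the remaining claims hold for corner elements of arbitrary ideals, or for
  arbitrary finitely generated monomial ideals.

  If \<open>f\<close> is a corner element of \<open>I\<close>, then \<open>(I : f)\<close> contains \<open>m = (x, y, z)\<close>; it cannot be larger, because a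
  polynomial with constant term \<open>c \<noteq> 0\<close> is \<open>c\<close> modulo \<open>m\<close>, so that it would force \<open>c f \<in> I\<close>
  (\<open>ideal_colon_corner_element\<close>). The same argument, with \<open>m\<close> in place of \<open>I\<close>, shows that \<open>m\<close> is prime.

  In a decomposition \<open>I = \<Inter>D\<close> into ideals generated by powers of variables, some \<open>J \<in> D\<close> avoids the
  corner element \<open>f\<close>, while \<open>x f, y f, z f \<in> J\<close>. Multiplication by \<open>x\<close> brings \<open>f\<close> into \<open>J\<close> only if
  \<open>J\<close> has the generator \<open>x\<^sup>n\<close> with \<open>n\<close> one above the exponent in \<open>f\<close>, and likewise for \<open>y\<close> and \<open>z\<close>.
  So \<open>J\<close> is \<open>P_R f\<close> (\<open>P_R_corner_element_mem_decomposition\<close>). Such a decomposition exists because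
  every monomial \<open>u\<close> outside \<open>I\<close> is avoided by the ideal generated by the pure powers that occur
  in the generators of \<open>I\<close> and do not divide \<open>u\<close>, an ideal that contains \<open>I\<close>
  (\<open>exists_irredundant_irreducible_decomposition\<close>).
\<close>

section \<open>Ideals generated by monomials\<close>

abbreviation mono_of :: "nat \<times> nat \<times> nat \<Rightarrow> 'k::field poly3"
  where "mono_of e \<equiv> Poly_Mapping.single e 1"

text \<open>
  The componentwise order on exponent triples is divisibility of monomials, so this is the ideal
  generated by the monomials with exponents in \<open>A\<close>, described through the terms of its members;
  see \<open>ideal_gen_monomials\<close>.
\<close>

definition polys_above :: "(nat \<times> nat \<times> nat) set \<Rightarrow> 'k::field poly3 set"
  where "polys_above A = {f. \<forall>e \<in> Poly_Mapping.keys f. \<exists>a\<in>A. a \<le> e}"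

lemma ideal_ring_of_type_algebra_iff:
  fixes I :: "'a::comm_ring_1 set"
  shows "ideal I ring_of_type_algebra \<longleftrightarrow>
    0 \<in> I \<and> (\<forall>f\<in>I. \<forall>g\<in>I. f + g \<in> I) \<and> (\<forall>f\<in>I. \<forall>p. p * f \<in> I)"
proof
  assume "ideal I ring_of_type_algebra"
  then interpret ideal I "ring_of_type_algebra :: 'a ring" .
  show "0 \<in> I \<and> (\<forall>f\<in>I. \<forall>g\<in>I. f + g \<in> I) \<and> (\<forall>f\<in>I. \<forall>p. p * f \<in> I)"
    using additive_subgroup.zero_closed[OF additive_subgroup_axioms]
      additive_subgroup.a_closed[OF additive_subgroup_axioms] I_l_closed
    unfolding ring_of_type_algebra_def by simp
next
  assume I: "0 \<in> I \<and> (\<forall>f\<in>I. \<forall>g\<in>I. f + g \<in> I) \<and> (\<forall>f\<in>I. \<forall>p. p * f \<in> I)"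
  interpret R: cring "ring_of_type_algebra :: 'a ring" by (rule cring_from_type_algebra)
  have neg: "\<ominus>\<^bsub>ring_of_type_algebra\<^esub> f = - f" for f :: 'a
    by (rule R.minus_equality) (simp_all add: ring_of_type_algebra_def)
  have uminus: "- f \<in> I" if "f \<in> I" for f
    using I that by (metis mult_minus1)
  show "ideal I ring_of_type_algebra"
  proof (rule idealI)
    show "subgroup I (add_monoid ring_of_type_algebra)"
      using I uminus neg
      by (intro subgroup.intro) (auto simp: ring_of_type_algebra_def a_inv_def)
  qed (use I R.ring_axioms in \<open>auto simp: ring_of_type_algebra_def mult.commute\<close>)
qed

lemma ideal_sum_closed:
  fixes I :: "'a::comm_ring_1 set"
  assumes "ideal I ring_of_type_algebra" "\<And>x. x \<in> B \<Longrightarrow> g x \<in> I"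
  shows "sum g B \<in> I"
  using assms(2) by (induction B rule: infinite_finite_induct)
    (use assms(1) in \<open>auto simp: ideal_ring_of_type_algebra_iff\<close>)

lemma ideal_ideal_gen: "ideal (ideal_gen S) poly3_ring"
proof -
  interpret R: cring "poly3_ring :: 'a poly3 ring" by (rule cring_from_type_algebra)
  show ?thesis by (rule R.genideal_ideal) (simp add: ring_of_type_algebra_def)
qed

lemma subset_ideal_gen: "S \<subseteq> ideal_gen S"
  by (auto simp: genideal_def)

lemma ideal_gen_subset: "ideal I poly3_ring \<Longrightarrow> S \<subseteq> I \<Longrightarrow> ideal_gen S \<subseteq> I"
  by (auto simp: genideal_def)

lemma poly_eq_sum_terms:
  fixes f :: "'k::field poly3"
  shows "f = (\<Sum>e\<in>Poly_Mapping.keys f. Poly_Mapping.single e (Poly_Mapping.lookup f e))"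
  by (rule poly_mapping_eqI)
    (simp add: lookup_sum lookup_single when_def in_keys_iff)

lemma ideal_polys_above: "ideal (polys_above A :: 'k::field poly3 set) poly3_ring"
proof -
  have zero: "(0 :: 'k poly3) \<in> polys_above A" by (simp add: polys_above_def)
  have add: "f + g \<in> polys_above A"
    if "f \<in> polys_above A" "g \<in> polys_above A" for f g :: "'k poly3"
    using that keys_add[of f g] unfolding polys_above_def by blast
  have mult: "p * f \<in> polys_above A" if f: "f \<in> polys_above A" for p f :: "'k poly3"
    unfolding polys_above_def
  proof safe
    fix a b c
    assume "(a, b, c) \<in> Poly_Mapping.keys (p * f)"
    then obtain d e where de: "(a, b, c) = d + e" "e \<in> Poly_Mapping.keys f"
      using keys_mult[of p f] by auto
    then obtain u where u: "u \<in> A" "u \<le> e"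
      using f unfolding polys_above_def by blast
    have "u \<le> (a, b, c)"
      using u(2) de(1) by (cases u; cases e; cases d) auto
    then show "\<exists>u\<in>A. u \<le> (a, b, c)" using u(1) by blast
  qed
  show ?thesis
    unfolding ideal_ring_of_type_algebra_iff using add mult zero by blast
qed

lemma mono_of_mem_polys_above: "mono_of e \<in> polys_above A \<longleftrightarrow> (\<exists>a\<in>A. a \<le> e)"
  by (simp add: polys_above_def)

text \<open>
  Every question about monomial ideals below reduces through this description to the order on
  exponents. A member of \<open>polys_above A\<close> is the sum of its terms, each a multiple of a generator.
\<close>

lemma ideal_gen_monomials:
  "ideal_gen (mono_of ` A) = (polys_above A :: 'k::field poly3 set)"
proof
  show "ideal_gen (mono_of ` A) \<subseteq> (polys_above A :: 'k poly3 set)"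
    by (rule ideal_gen_subset[OF ideal_polys_above]) (auto simp: mono_of_mem_polys_above)
next
  let ?I = "ideal_gen (mono_of ` A) :: 'k poly3 set"
  have term_mem: "Poly_Mapping.single e c \<in> ?I" if a: "a \<in> A" "a \<le> e" for a e and c :: 'k
  proof -
    obtain d where d: "e = d + a"
    proof
      show "e = (fst e - fst a, fst (snd e) - fst (snd a), snd (snd e) - snd (snd a)) + a"
        using a(2) by (cases e; cases a) auto
    qed
    have "Poly_Mapping.single e c = Poly_Mapping.single d c * mono_of a"
      by (simp add: d Poly_Mapping.mult_single)
    moreover have "mono_of a \<in> ?I" using subset_ideal_gen imageI[OF a(1)] by (rule subsetD)
    moreover have "\<forall>f\<in>?I. \<forall>p. p * f \<in> ?I"
      using ideal_ideal_gen unfolding ideal_ring_of_type_algebra_iff by blast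
    ultimately show ?thesis by simp
  qed
  show "polys_above A \<subseteq> ?I"
  proof
    fix f :: "'k poly3"
    assume "f \<in> polys_above A"
    then have "(\<Sum>e\<in>Poly_Mapping.keys f. Poly_Mapping.single e (Poly_Mapping.lookup f e)) \<in> ?I"
      by (intro ideal_sum_closed[OF ideal_ideal_gen]) (auto simp: polys_above_def intro: term_mem)
    then show "f \<in> ?I" using poly_eq_sum_terms[of f] by simp
  qed
qed

lemma polys_above_subset_iff:
  "(polys_above A :: 'k::field poly3 set) \<subseteq> polys_above B \<longleftrightarrow> (\<forall>a\<in>A. \<exists>b\<in>B. b \<le> a)"
proof
  assume sub: "(polys_above A :: 'k poly3 set) \<subseteq> polys_above B"
  show "\<forall>a\<in>A. \<exists>b\<in>B. b \<le> a"
  proof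
    fix a assume "a \<in> A"
    then have "(mono_of a :: 'k poly3) \<in> polys_above A"
      unfolding mono_of_mem_polys_above by blast
    with sub have "(mono_of a :: 'k poly3) \<in> polys_above B" by blast
    then show "\<exists>b\<in>B. b \<le> a" unfolding mono_of_mem_polys_above .
  qed
next
  assume "\<forall>a\<in>A. \<exists>b\<in>B. b \<le> a"
  then show "(polys_above A :: 'k poly3 set) \<subseteq> polys_above B"
    unfolding polys_above_def by (blast intro: order_trans)
qed

section \<open>Corner elements and the maximal ideal\<close>

lemma maximal_m_eq: "(maximal_m :: 'k::field poly3 set) = {f. Poly_Mapping.lookup f 0 = 0}"
proof -
  have pos: "(\<exists>a\<in>{(1, 0, 0), (0, 1, 0), (0, 0, 1)}. a \<le> e) \<longleftrightarrow> e \<noteq> 0" for e :: "nat \<times> nat \<times> nat"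
    by (cases e) (auto simp: zero_prod_def)
  have "{var_x, var_y, var_z} = (mono_of ` {(1, 0, 0), (0, 1, 0), (0, 0, 1)} :: 'k poly3 set)"
    by (simp add: var_x_def var_y_def var_z_def)
  then have "(maximal_m :: 'k poly3 set) = polys_above {(1, 0, 0), (0, 1, 0), (0, 0, 1)}"
    by (simp only: maximal_m_def ideal_gen_monomials)
  also have "\<dots> = {f. Poly_Mapping.lookup f 0 = 0}"
    unfolding polys_above_def pos by (metis in_keys_iff)
  finally show ?thesis .
qed

lemma ideal_maximal_m: "ideal (maximal_m :: 'k::field poly3 set) poly3_ring"
  unfolding maximal_m_def by (rule ideal_ideal_gen)

text \<open>The residue field of \<open>m\<close> is \<open>K\<close>: modulo \<open>m\<close>, a polynomial is its constant term.\<close>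

lemma constant_term_split:
  fixes f :: "'k::field poly3"
  obtains g where "g \<in> maximal_m" "f = Poly_Mapping.single 0 (Poly_Mapping.lookup f 0) + g"
proof
  show "f - Poly_Mapping.single 0 (Poly_Mapping.lookup f 0) \<in> maximal_m"
    by (simp add: maximal_m_eq lookup_minus)
qed simp

lemma unit_constant_mult_mem_cancel:
  fixes f :: "'k::field poly3"
  assumes I: "ideal I poly3_ring" and c: "c \<noteq> 0" and mem: "Poly_Mapping.single 0 c * f \<in> I"
  shows "f \<in> I"
proof -
  have "Poly_Mapping.single 0 (inverse c) * (Poly_Mapping.single 0 c * f) = f"
    using c by (simp add: Poly_Mapping.mult_single flip: mult.assoc)
  then show ?thesis using I mem by (metis ideal_ring_of_type_algebra_iff)
qed

text \<open>
  A proper colon ideal that contains \<open>m\<close> is contained in it: a member \<open>p\<close> with constant term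
  \<open>c \<noteq> 0\<close> would put \<open>c\<close> itself, a unit, into the colon ideal. With \<open>I = m\<close> this is primality of
  \<open>m\<close>; with \<open>f\<close> a corner element it computes the colon ideal.
\<close>

lemma mem_colon_imp_mem_maximal_m:
  fixes f p :: "'k::field poly3"
  assumes I: "ideal I poly3_ring" and f: "f \<notin> I" and mf: "\<And>g. g \<in> maximal_m \<Longrightarrow> g * f \<in> I"
    and pf: "p * f \<in> I"
  shows "p \<in> maximal_m"
proof (rule ccontr)
  assume "p \<notin> maximal_m"
  then have c: "Poly_Mapping.lookup p 0 \<noteq> 0" by (simp add: maximal_m_eq)
  obtain g where g: "g \<in> maximal_m" "p = Poly_Mapping.single 0 (Poly_Mapping.lookup p 0) + g"
    by (rule constant_term_split)
  have "Poly_Mapping.single 0 (Poly_Mapping.lookup p 0) * f = p * f + (- 1) * (g * f)"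
    by (subst (2) g(2)) (simp add: algebra_simps)
  also have "\<dots> \<in> I" using I pf mf[OF g(1)] unfolding ideal_ring_of_type_algebra_iff by blast
  finally show False using unit_constant_mult_mem_cancel[OF I c] f by blast
qed

lemma primeideal_maximal_m: "primeideal (maximal_m :: 'k::field poly3 set) poly3_ring"
proof (rule primeidealI)
  show "ideal (maximal_m :: 'k poly3 set) poly3_ring" by (rule ideal_maximal_m)
  show "cring (poly3_ring :: 'k poly3 ring)" by (rule cring_from_type_algebra)
  have "(1 :: 'k poly3) \<notin> maximal_m" by (simp add: maximal_m_eq)
  then show "carrier poly3_ring \<noteq> (maximal_m :: 'k poly3 set)"
    by (auto simp: ring_of_type_algebra_def)
  fix p f :: "'k poly3"
  assume "p \<otimes>\<^bsub>poly3_ring\<^esub> f \<in> maximal_m"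
  then have pf: "p * f \<in> maximal_m" by (simp add: ring_of_type_algebra_def)
  have "g * f \<in> maximal_m" if "g \<in> maximal_m" for g
    using ideal_maximal_m[where 'k = 'k] that
    unfolding ideal_ring_of_type_algebra_iff by (metis mult.commute)
  with pf show "p \<in> maximal_m \<or> f \<in> maximal_m"
    using mem_colon_imp_mem_maximal_m[OF ideal_maximal_m] by blast
qed

lemma ideal_colon_corner_element:
  fixes f :: "'k::field poly3"
  assumes I: "ideal I poly3_ring" and f: "f \<in> corner_elements I"
  shows "ideal_colon I f = maximal_m"
proof
  have "ideal (ideal_colon I f) poly3_ring"
    using I by (simp add: ideal_ring_of_type_algebra_iff ideal_colon_def distrib_right mult.assoc)
  moreover have "{var_x, var_y, var_z} \<subseteq> ideal_colon I f"
    using f by (simp add: corner_elements_def ideal_colon_def)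
  ultimately show m_sub: "maximal_m \<subseteq> ideal_colon I f"
    unfolding maximal_m_def by (rule ideal_gen_subset)
  show "ideal_colon I f \<subseteq> maximal_m"
    using mem_colon_imp_mem_maximal_m[OF I, of f] f m_sub
    by (auto simp: ideal_colon_def corner_elements_def)
qed

corollary maximal_m_mem_Ass:
  assumes "ideal I poly3_ring" "f \<in> corner_elements I"
  shows "maximal_m \<in> Ass I"
  using ideal_colon_corner_element[OF assms] primeideal_maximal_m by (auto simp: Ass_def)

section \<open>Irreducible decompositions\<close>

definition axis_exponents :: "(nat \<times> nat \<times> nat) set"
  where "axis_exponents =
    {(n, 0, 0) | n. n \<ge> 1} \<union> {(0, n, 0) | n. n \<ge> 1} \<union> {(0, 0, n) | n. n \<ge> 1}"

lemma gen_by_variable_powers_iff: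
  "gen_by_variable_powers (J :: 'k::field poly3 set) \<longleftrightarrow>
    (\<exists>E \<subseteq> axis_exponents. J = polys_above E)"
proof -
  have "{v ^ n | v n. v \<in> {var_x, var_y, var_z :: 'k poly3} \<and> n \<ge> 1} = mono_of ` axis_exponents"
    unfolding axis_exponents_def by (auto simp: var_power) (metis var_power)+
  then show ?thesis
    unfolding gen_by_variable_powers_def
    by (simp only: subset_image_iff) (metis ideal_gen_monomials)
qed

lemma exists_irredundant_subfamily:
  assumes "finite \<D>" "\<Inter>\<D> = I"
  shows "\<exists>D \<subseteq> \<D>. \<Inter>D = I \<and> (\<forall>J\<in>D. \<Inter>(D - {J}) \<noteq> I)"
proof -
  have "finite {D. D \<subseteq> \<D> \<and> \<Inter>D = I}" using assms(1) by simp
  moreover have "{D. D \<subseteq> \<D> \<and> \<Inter>D = I} \<noteq> {}" using assms(2) by blast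
  ultimately have "\<exists>D\<in>{D. D \<subseteq> \<D> \<and> \<Inter>D = I}. \<forall>D'\<in>{D. D \<subseteq> \<D> \<and> \<Inter>D = I}. D' \<subseteq> D \<longrightarrow> D = D'"
    by (rule finite_has_minimal)
  then obtain D where D: "D \<subseteq> \<D>" "\<Inter>D = I"
    and min: "\<And>D'. D' \<subseteq> \<D> \<Longrightarrow> \<Inter>D' = I \<Longrightarrow> D' \<subseteq> D \<Longrightarrow> D = D'"
    by (simp only: mem_Collect_eq Bex_def Ball_def) metis
  have "\<Inter>(D - {J}) \<noteq> I" if "J \<in> D" for J
    using min[of "D - {J}"] D(1) that by blast
  then show ?thesis using D by blast
qed

text \<open>
  Candidates are all ideals that contain the given one and are generated by some of the pure powers
  \<open>x\<^sup>a\<close>, \<open>y\<^sup>b\<close>, \<open>z\<^sup>c\<close> read off from its generators; they are finitely many. To exclude a monomial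
  outside the ideal, take the pure powers that do not divide it: each generator fails to divide it
  in some coordinate, and therefore lies above one of them.
\<close>

lemma exists_irredundant_irreducible_decomposition:
  assumes "finite A"
  shows "\<exists>D. irredundant_irreducible_decomposition (polys_above A :: 'k::field poly3 set) D"
proof -
  \<comment> \<open>The intersection removes the exponent 0, which would stand for the power \<open>1\<close> of a variable.\<close>
  define T where "T = (\<Union>(a, b, c)\<in>A. {(a, 0, 0), (0, b, 0), (0, 0, c)}) \<inter> axis_exponents"
  define \<E> where "\<E> = {E. E \<subseteq> T \<and> (\<forall>a\<in>A. \<exists>t\<in>E. t \<le> a)}"
  define \<D> where "\<D> = (polys_above ` \<E> :: 'k poly3 set set)"
  have "finite T" using assms by (auto simp: T_def)
  then have "finite \<D>" by (simp add: \<D>_def \<E>_def)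
  moreover have "\<Inter>\<D> = polys_above A"
  proof
    show "polys_above A \<subseteq> \<Inter>\<D>"
      by (auto simp: \<D>_def \<E>_def polys_above_subset_iff[THEN iffD2, THEN subsetD])
  next
    show "\<Inter>\<D> \<subseteq> polys_above A"
    proof
      fix f assume f: "f \<in> \<Inter>\<D>"
      show "f \<in> polys_above A"
        unfolding polys_above_def
      proof (rule CollectI, rule ballI, rule ccontr)
        fix e
        assume e: "e \<in> Poly_Mapping.keys f" and not_above: "\<not> (\<exists>a\<in>A. a \<le> e)"
        define E where "E = {t \<in> T. \<not> t \<le> e}"
        have "\<exists>t\<in>E. t \<le> a" if a: "a \<in> A" for a
        proof -
          obtain a1 a2 a3 e1 e2 e3 where eqs: "a = (a1, a2, a3)" "e = (e1, e2, e3)"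
            by (cases a; cases e) auto
          then have "a1 > e1 \<or> a2 > e2 \<or> a3 > e3" using not_above a by auto
          moreover have "(a1, 0, 0) \<in> E" if "a1 > e1"
            using that a eqs by (auto simp: E_def T_def axis_exponents_def)
          moreover have "(0, a2, 0) \<in> E" if "a2 > e2"
            using that a eqs by (auto simp: E_def T_def axis_exponents_def)
          moreover have "(0, 0, a3) \<in> E" if "a3 > e3"
            using that a eqs by (auto simp: E_def T_def axis_exponents_def)
          ultimately show ?thesis unfolding eqs by (metis Pair_le le0 le_refl)
        qed
        then have "E \<in> \<E>" by (auto simp: \<E>_def E_def)
        then have "f \<in> polys_above E" using f by (auto simp: \<D>_def)
        then show False using e by (auto simp: polys_above_def E_def)
      qed
    qed
  qed
  ultimately obtain D where D: "D \<subseteq> \<D>" "\<Inter>D = polys_above A" "\<forall>J\<in>D. \<Inter>(D - {J}) \<noteq> polys_above A"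
    using exists_irredundant_subfamily by metis
  have "\<forall>J\<in>\<D>. gen_by_variable_powers J"
    by (auto simp: \<D>_def \<E>_def T_def gen_by_variable_powers_iff)
  then show ?thesis
    using D \<open>finite \<D>\<close> unfolding irredundant_irreducible_decomposition_def
    by (meson finite_subset subsetD)
qed

lemma P_R_eq_polys_above:
  "P_R (xyz_mon a b c :: 'k::field poly3) =
    polys_above {(a + 1, 0, 0), (0, b + 1, 0), (0, 0, c + 1)}"
proof -
  have "{var_x ^ (a + 1), var_y ^ (b + 1), var_z ^ (c + 1)} =
    (mono_of ` {(a + 1, 0, 0), (0, b + 1, 0), (0, 0, c + 1)} :: 'k poly3 set)"
    by (simp add: var_power del: power_Suc)
  then show ?thesis by (simp only: P_R_xyz_mon ideal_gen_monomials)
qed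

lemma var_mult_xyz_mon:
  "var_x * (xyz_mon a b c :: 'k::field poly3) = mono_of (Suc a, b, c)"
  "var_y * (xyz_mon a b c :: 'k::field poly3) = mono_of (a, Suc b, c)"
  "var_z * (xyz_mon a b c :: 'k::field poly3) = mono_of (a, b, Suc c)"
  by (simp_all add: xyz_mon_eq_single var_x_def var_y_def var_z_def Poly_Mapping.mult_single)

text \<open>
  The component equal to \<open>P_R f\<close> is any \<open>J \<in> D\<close> that avoids \<open>f\<close>. Such a \<open>J\<close> has only generators
  with exponents beyond those of \<open>f\<close>, and \<open>x f, y f, z f \<in> J\<close> force the smallest possible power of
  each variable to occur among them.
\<close>

lemma P_R_corner_element_mem_decomposition:
  fixes I :: "'k::field poly3 set"
  assumes D: "irredundant_irreducible_decomposition I D" and f: "f \<in> corner_elements I"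
  shows "P_R f \<in> D"
proof -
  obtain a b c where abc: "f = xyz_mon a b c"
    using f by (auto simp: corner_elements_def monomials_def)
  have "f \<notin> \<Inter>D"
    using f D by (simp add: corner_elements_def irredundant_irreducible_decomposition_def)
  then obtain J where J: "J \<in> D" "f \<notin> J" by blast
  then have "gen_by_variable_powers J"
    using D unfolding irredundant_irreducible_decomposition_def by blast
  then obtain E where E: "E \<subseteq> axis_exponents" "J = polys_above E"
    unfolding gen_by_variable_powers_iff by blast
  have "I \<subseteq> J" using D J(1) unfolding irredundant_irreducible_decomposition_def by blast
  then have vars: "var_x * f \<in> J" "var_y * f \<in> J" "var_z * f \<in> J"
    using f by (auto simp: corner_elements_def)
  have not_below: "\<not> t \<le> (a, b, c)" if "t \<in> E" for t
    using J(2) that unfolding E(2) abc xyz_mon_eq_single mono_of_mem_polys_above by blast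
  have axis: "(\<exists>n. t = (n, 0, 0) \<and> n > a) \<or> (\<exists>n. t = (0, n, 0) \<and> n > b) \<or> (\<exists>n. t = (0, 0, n) \<and> n > c)"
    if "t \<in> E" for t
  proof -
    have "t \<in> axis_exponents" using E(1) that by (rule subsetD)
    then show ?thesis using not_below[OF that] by (auto simp: axis_exponents_def)
  qed
  have above: "\<exists>t\<in>E. t \<le> (Suc a, b, c)" "\<exists>t\<in>E. t \<le> (a, Suc b, c)" "\<exists>t\<in>E. t \<le> (a, b, Suc c)"
    using vars unfolding abc E(2) var_mult_xyz_mon mono_of_mem_polys_above by auto
  (* Of the generators of J, only the power of x can lie below x f, and only with exponent a + 1. *)
  have x: "(a + 1, 0, 0) \<in> E"
  proof -
    obtain t where "t \<in> E" "t \<le> (Suc a, b, c)" using above(1) by blast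
    then have "t = (a + 1, 0, 0)" using axis[of t] by auto
    then show ?thesis using \<open>t \<in> E\<close> by simp
  qed
  have y: "(0, b + 1, 0) \<in> E"
  proof -
    obtain t where "t \<in> E" "t \<le> (a, Suc b, c)" using above(2) by blast
    then have "t = (0, b + 1, 0)" using axis[of t] by auto
    then show ?thesis using \<open>t \<in> E\<close> by simp
  qed
  have z: "(0, 0, c + 1) \<in> E"
  proof -
    obtain t where "t \<in> E" "t \<le> (a, b, Suc c)" using above(3) by blast
    then have "t = (0, 0, c + 1)" using axis[of t] by auto
    then show ?thesis using \<open>t \<in> E\<close> by simp
  qed
  have "J = P_R f"
    unfolding E(2) abc P_R_eq_polys_above
  proof
    show "polys_above E \<subseteq> polys_above {(a + 1, 0, 0), (0, b + 1, 0), (0, 0, c + 1)}"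
      unfolding polys_above_subset_iff using axis by fastforce
    show "polys_above {(a + 1, 0, 0), (0, b + 1, 0), (0, 0, c + 1)} \<subseteq> polys_above E"
      unfolding polys_above_subset_iff using x y z by blast
  qed
  then show ?thesis using J(1) by simp
qed

section \<open>A corner element read off from ordered generators\<close>

theorem proposition3p3:
  fixes I :: "'k::field poly3 set"
    and r :: "nat \<Rightarrow> nat \<Rightarrow> nat"
    and k s :: nat
  assumes "monomial_ideal I"
    and "k \<ge> 3"
    and "minimal_monomial_generators I ((\<lambda>i. xyz_mon (r i 1) (r i 2) (r i 3)) ` {1..k})"
    and "inj_on (\<lambda>i. xyz_mon (r i 1) (r i 2) (r i 3) :: 'k poly3) {1..k}"
    and "1 \<le> s" and "s \<le> k - 2"
    and "\<forall>i\<in>{1..<s}. r i 1 \<ge> r (i + 1) 1"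
    and "r s 1 > r (s + 1) 1" and "r s 1 > r (s + 2) 1"
    and "r (s + 1) 2 > r s 2" and "r (s + 1) 2 > r (s + 2) 2"
    and "r (s + 1) 3 < r (s + 2) 3"
    and "\<forall>i\<in>{s + 2..<k}. r i 3 \<le> r (i + 1) 3"
    and "r s 3 < r (s + 2) 3"
  defines "h \<equiv> xyz_mon (r s 1 - 1) (r (s + 1) 2 - 1) (r (s + 2) 3 - 1) :: 'k poly3"
  shows "maximal_m \<in> Ass I \<and>
    h \<in> corner_elements I \<and>
    P_R h = ideal_gen {var_x ^ r s 1, var_y ^ r (s + 1) 2, var_z ^ r (s + 2) 3} \<and>
    (\<exists>D. irredundant_irreducible_decomposition I D) \<and>
    (\<forall>D. irredundant_irreducible_decomposition I D \<longrightarrow> P_R h \<in> D)"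
proof -
  define A where "A = (\<lambda>i. (r i 1, r i 2, r i 3)) ` {1..k}"
  have I_gen: "I = ideal_gen ((\<lambda>i. xyz_mon (r i 1) (r i 2) (r i 3)) ` {1..k})"
    using assms(3) by (simp add: minimal_monomial_generators_def)
  have I: "I = polys_above A"
    unfolding I_gen A_def by (simp add: xyz_mon_eq_single image_image flip: ideal_gen_monomials)
  have idx: "s \<in> {1..k}" "s + 1 \<in> {1..k}" "s + 2 \<in> {1..k}"
    using assms(2,5,6) by auto
  have x_desc: "r s 1 \<le> r i 1" if "1 \<le> i" "i \<le> s" for i
    using that(2,1)
  proof (induction rule: inc_induct)
    case (step n)
    then show ?case using assms(7) by (metis Suc_eq_plus1 atLeastLessThan_iff le_SucI order_trans)
  qed simp
  have z_asc: "r (s + 2) 3 \<le> r i 3" if "s + 2 \<le> i" "i \<le> k" for i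
    using that
  proof (induction rule: dec_induct)
    case (step n)
    then have "r n 3 \<le> r (n + 1) 3" using assms(13) by simp
    with step show ?case by simp
  qed simp
  \<comment> \<open>
    The three exponents of the generators that define \<open>h\<close> are positive by the strict inequalities,
    so the truncated subtractions of 1 are genuine.
  \<close>
  have not_below: "\<not> (r i 1, r i 2, r i 3) \<le> (r s 1 - 1, r (s + 1) 2 - 1, r (s + 2) 3 - 1)"
    if i: "i \<in> {1..k}" for i
  proof -
    consider "i \<le> s" | "i = s + 1" | "s + 2 \<le> i" by linarith
    then show ?thesis
    proof cases
      case 1
      then show ?thesis using x_desc[of i] i assms(8) by simp
    next
      case 2
      then show ?thesis using assms(10) by simp
    next
      case 3
      then have "r (s + 2) 3 - 1 < r i 3" using z_asc[of i] i assms(12) by simp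
      then show ?thesis by simp
    qed
  qed
  have corner: "h \<in> corner_elements I"
  proof -
    have "h \<in> monomials" by (auto simp: h_def monomials_def)
    moreover have "h \<notin> I"
      unfolding I h_def xyz_mon_eq_single mono_of_mem_polys_above using not_below by (auto simp: A_def)
    moreover have "var_x * h \<in> I"
      unfolding I h_def var_mult_xyz_mon mono_of_mem_polys_above A_def
      using idx(1) assms(8,10,14) by (intro bexI[OF _ imageI[of s]]) auto
    moreover have "var_y * h \<in> I"
      unfolding I h_def var_mult_xyz_mon mono_of_mem_polys_above A_def
      using idx(2) assms(8,10,12) by (intro bexI[OF _ imageI[of "s + 1"]]) auto
    moreover have "var_z * h \<in> I"
      unfolding I h_def var_mult_xyz_mon mono_of_mem_polys_above A_def
      using idx(3) assms(9,11,12) by (intro bexI[OF _ imageI[of "s + 2"]]) auto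
    ultimately show ?thesis by (simp add: corner_elements_def)
  qed
  have "P_R h = ideal_gen {var_x ^ r s 1, var_y ^ r (s + 1) 2, var_z ^ r (s + 2) 3}"
    unfolding h_def P_R_xyz_mon using assms(8,10,12) by simp
  moreover have "maximal_m \<in> Ass I"
    using maximal_m_mem_Ass corner ideal_polys_above unfolding I by blast
  moreover have "\<exists>D. irredundant_irreducible_decomposition I D"
    unfolding I by (rule exists_irredundant_irreducible_decomposition) (simp add: A_def)
  ultimately show ?thesis
    using corner P_R_corner_element_mem_decomposition by blast
qed

end
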